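(* If $S\subseteq\mathbb{Z}^d$ is a bounded, axis-symmetric, axis-convex set, the object localization problem is $(4d+1)$-split-neighborly. That is: let $d\ge1$, let $S\subseteq\mathbb{Z}^d$ be a bounded, axis-symmetric, axis-convex set, let $\mathcal{X}=\mathbb{Z}^d$, for $z\in\mathbb{Z}^d$ let $h_z:\mathcal{X}\to\{0,1\}$ be $h_z(x)=\mathbf{1}[x-z\in S]$, and let $\mathcal{H}\subseteq\{h_z\}_{z\in\mathbb{Z}^d}$ be finite. Then $(\mathcal{H},\mathcal{X})$ is $(4d+1)$-split-neighborly.
   Context: Axis-symmetric: $S$ is invariant under changing the sign of any single coordinate. Axis-convex: if two points of $S$ differ in only one coordinate, then all integer points on the segment between them are also in $S$. Elements of $\mathcal{H}$ are hypotheses, elements of $\mathcal{X}$ are tests. For a nonempty finite set $V$, $\mathbb{E}_{h\in V}[f(h)]=\frac{1}{|V|}\sum_{h\in V}f(h)$. For tests $x,x'$ let $\Delta(x,x')=\{h\in\mathcal{H}: h(x)=0 \wedge h(x')=1\}$. For $\alpha\in(0,\frac12]$, define a directed graph on $\mathcal{X}$ with a directed edge $(x,x')$ iff for every $V\subseteq\Delta(x,x')$, either $|V|\le 1$ or there exists a test $\hat x\in\mathcal{X}$ with $\mathbb{E}_{h\in V}[h(\hat x)]\in[\alpha,1-\alpha]$. The problem is $\frac1\alpha$-split-neighborly if this graph is strongly connected. *)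

theory Defs
  imports "HOL-Analysis.Analysis" "Graph_Theory.Pair_Digraph" "Graph_Theory.Digraph_Component"
begin

text \<open>
  The set of tests is the whole type \<open>'x\<close>. A hypothesis, a map from tests to $\{0,1\}$, is a
  predicate on \<open>'x\<close>; its values enter averages through \<^const>\<open>of_bool\<close>. The set \<open>H\<close> of
  hypotheses is meant to be finite (\<^const>\<open>card\<close> is \<open>0\<close> on infinite sets).
\<close>

definition avg :: "'a set \<Rightarrow> ('a \<Rightarrow> real) \<Rightarrow> real" where
  "avg V f = (1 / real (card V)) * (\<Sum>h\<in>V. f h)"

definition Delta :: "('x \<Rightarrow> bool) set \<Rightarrow> 'x \<Rightarrow> 'x \<Rightarrow> ('x \<Rightarrow> bool) set" where
  "Delta H x x' = {h \<in> H. \<not> h x \<and> h x'}"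

definition split_graph :: "real \<Rightarrow> ('x \<Rightarrow> bool) set \<Rightarrow> 'x pair_pre_digraph" where
  "split_graph \<alpha> H =
     \<lparr> pverts = UNIV,
       parcs = {(x, x'). \<forall>V \<subseteq> Delta H x x'.
                  card V \<le> 1 \<or> (\<exists>t. avg V (\<lambda>h. of_bool (h t)) \<in> {\<alpha>..1 - \<alpha>})} \<rparr>"

definition split_neighborly :: "real \<Rightarrow> ('x \<Rightarrow> bool) set \<Rightarrow> bool" where
  "split_neighborly k H \<longleftrightarrow>
     (\<exists>\<alpha>. 0 < \<alpha> \<and> \<alpha> \<le> 1/2 \<and> k = 1 / \<alpha> \<and> strongly_connected (with_proj (split_graph \<alpha> H)))"

text \<open>\<open>int\<close> is not a metric space in the library, so boundedness is taken in $R^d$.\<close>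

definition bounded_lattice_set :: "(int ^ 'd) set \<Rightarrow> bool" where
  "bounded_lattice_set S \<longleftrightarrow> bounded ((\<lambda>s. (\<chi> i. real_of_int (s $ i)) :: real ^ 'd) ` S)"

definition flip_coord :: "'d \<Rightarrow> int ^ 'd \<Rightarrow> int ^ 'd" where
  "flip_coord i s = (\<chi> j. if j = i then - (s $ j) else s $ j)"

definition axis_symmetric :: "(int ^ 'd) set \<Rightarrow> bool" where
  "axis_symmetric S \<longleftrightarrow> (\<forall>i. flip_coord i ` S = S)"

text \<open>
  Ordering the two endpoints by their \<open>i\<close>-th coordinate loses nothing, since \<open>a\<close> and \<open>b\<close>
  play symmetric roles.
\<close>

definition axis_convex :: "(int ^ 'd) set \<Rightarrow> bool" where
  "axis_convex S \<longleftrightarrow>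
     (\<forall>a\<in>S. \<forall>b\<in>S. \<forall>i. (\<forall>j. j \<noteq> i \<longrightarrow> a $ j = b $ j) \<longrightarrow>
        (\<forall>c. (\<forall>j. j \<noteq> i \<longrightarrow> c $ j = a $ j) \<and> a $ i \<le> c $ i \<and> c $ i \<le> b $ i \<longrightarrow> c \<in> S))"

definition loc_hyp :: "(int ^ 'd) set \<Rightarrow> int ^ 'd \<Rightarrow> (int ^ 'd \<Rightarrow> bool)" where
  "loc_hyp S z = (\<lambda>x. x - z \<in> S)"

end

theory Submission
  imports Defs
begin

text \<open>
  Every pair of tests \<open>(x, x')\<close> is an edge, and only \<open>h x'\<close> for all \<open>h \<in> V\<close> matters. Let
  \<open>\<alpha> = 1/(4d+1)\<close> and suppose that no test splits \<open>V\<close>. Along each of the \<open>2d\<close> rays from \<open>x'\<close> in an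
  axis direction, the fraction of \<open>V\<close> that accepts the test falls from \<open>1\<close> to \<open>0\<close>, so at some step it
  jumps from above \<open>1-\<alpha>\<close> to below \<open>\<alpha>\<close>: up to a fraction \<open>2\<alpha>\<close>, all hypotheses stop accepting at that
  very step. By symmetry and convexity, the exit times on the two rays of axis \<open>j\<close> determine the \<open>j\<close>-th
  coordinate of the location. So all but a fraction \<open>4d\<alpha> = 1 - \<alpha>\<close> of \<open>V\<close> is a single hypothesis, hence
  \<open>|V| \<le> 1/\<alpha>\<close>. Then a fraction below \<open>\<alpha>\<close> is zero, so no test separates two members of \<open>V\<close>.
\<close>

text \<open>Let \<open>s\<close> be the last step before the accepting set first becomes small, i.e.
  of size below \<open>card V / c\<close>. At \<open>s\<close> the unsplit condition makes the
  rejecting set small, and at \<open>Suc s\<close> the accepting set is small. The exceptional set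
  is the union of these two.\<close>

lemma ex_common_drop:
  fixes Q :: "nat \<Rightarrow> 'a \<Rightarrow> bool" and c :: nat
  assumes "finite V" and "V \<noteq> {}" and "c \<ge> 1"
    and unsplit: "\<And>s. c * card {v\<in>V. Q s v} < card V \<or> c * card {v\<in>V. \<not> Q s v} < card V"
    and start: "\<And>v. v \<in> V \<Longrightarrow> Q 0 v"
    and stop: "\<And>v. v \<in> V \<Longrightarrow> \<not> Q N v"
  obtains s where "c * card {v\<in>V. \<not> Q s v \<or> Q (Suc s) v} \<le> 2 * card V"
proof -
  define P where "P s \<longleftrightarrow> c * card {v\<in>V. Q s v} < card V" for s
  have empty: "{v\<in>V. Q N v} = {}"
    using stop by auto
  have "P N"
    unfolding P_def empty using assms(1,2) by (simp add: card_gt_0_iff)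
  moreover have "{v\<in>V. Q 0 v} = V"
    using start by auto
  then have "\<not> P 0"
    using \<open>c \<ge> 1\<close> by (simp add: P_def)
  ultimately obtain s where s: "\<not> P s" "P (Suc s)"
    using ex_least_nat_less[of P N] by blast
  have "card {v\<in>V. \<not> Q s v \<or> Q (Suc s) v} \<le> card {v\<in>V. \<not> Q s v} + card {v\<in>V. Q (Suc s) v}"
    by (rule order_trans[OF card_mono card_Un_le]) (use assms(1) in auto)
  then have "c * card {v\<in>V. \<not> Q s v \<or> Q (Suc s) v}
      \<le> c * card {v\<in>V. \<not> Q s v} + c * card {v\<in>V. Q (Suc s) v}"
    unfolding add_mult_distrib2[symmetric] by (rule mult_le_mono2)
  also have "\<dots> \<le> 2 * card V"
    using s unsplit[of s] by (simp add: P_def)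
  finally show thesis
    using that by blast
qed

lemma bounded_lattice_setE:
  fixes S :: "(int ^ 'd) set"
  assumes "bounded_lattice_set S"
  obtains M :: nat where "\<And>w j. w \<in> S \<Longrightarrow> \<bar>w $ j\<bar> \<le> int M"
proof -
  obtain B where B: "\<And>w. w \<in> S \<Longrightarrow> norm ((\<chi> i. real_of_int (w $ i)) :: real ^ 'd) \<le> B"
    using assms unfolding bounded_lattice_set_def bounded_iff by auto
  have "\<bar>w $ j\<bar> \<le> int (nat \<lceil>B\<rceil>)" if "w \<in> S" for w j
  proof -
    have "\<bar>real_of_int (w $ j)\<bar> \<le> B"
      using component_le_norm_cart[of "\<chi> i. real_of_int (w $ i)" j] B[OF that] by simp
    then show ?thesis
      by linarith
  qed
  then show thesis
    using that by blast
qed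

lemma axis_convex_line:
  assumes "axis_convex S" and "w + axis j a \<in> S" and "w + axis j b \<in> S" and "a \<le> c" "c \<le> b"
  shows "w + axis j c \<in> S"
  using assms(1)[unfolded axis_convex_def, rule_format, OF assms(2,3), of j "w + axis j c"] assms(4,5)
  by (simp add: axis_def)

text \<open>On the line through \<open>w\<close> in direction \<open>j\<close>, the sign flip of
  coordinate \<open>j\<close> reflects offsets about \<open>- w $ j\<close>.\<close>

lemma axis_symmetric_line:
  assumes "axis_symmetric S" and "w + axis j a \<in> S"
  shows "w + axis j (- 2 * w $ j - a) \<in> S"
proof -
  have "flip_coord j (w + axis j a) = w + axis j (- 2 * w $ j - a)"
    by (auto simp: flip_coord_def axis_def vec_eq_iff)
  then show ?thesis
    using assms unfolding axis_symmetric_def by (metis image_eqI)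
qed

text \<open>The offsets that land in \<open>S\<close> form an integer interval symmetric about
  \<open>- w $ j\<close>. The hypotheses name its ends \<open>- q\<close> and \<open>p\<close>, so
  \<open>- w $ j\<close> is their midpoint. Otherwise the mirror image of one end would lie beyond
  the other end and convexity would fill the gap.\<close>

lemma coord_of_exit_times:
  assumes "axis_symmetric S" and "axis_convex S"
    and "w + axis j p \<in> S" and "w + axis j (p + 1) \<notin> S"
    and "w + axis j (- q) \<in> S" and "w + axis j (- q - 1) \<notin> S"
  shows "2 * w $ j = q - p"
proof (rule antisym)
  show "q - p \<le> 2 * w $ j"
    using axis_convex_line[OF assms(2,3) axis_symmetric_line[OF assms(1,5)], of "p + 1"] assms(4)
    by linarith
  show "2 * w $ j \<le> q - p"
    using axis_convex_line[OF assms(2) axis_symmetric_line[OF assms(1,3)] assms(5), of "- q - 1"] assms(6)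
    by linarith
qed

text \<open>Contrapositive form of the edge condition at the head \<open>x\<close>, with \<alpha> =
  1/(4d+1) and denominators cleared.\<close>

lemma unsplit_imp_subsingleton:
  fixes S :: "(int ^ 'd) set" and V :: "(int ^ 'd \<Rightarrow> bool) set"
  assumes bdd: "bounded_lattice_set S" and sym: "axis_symmetric S" and conv: "axis_convex S"
    and "V \<subseteq> range (loc_hyp S)" and fin: "finite V"
    and x: "\<And>h. h \<in> V \<Longrightarrow> h x"
    and unsplit: "\<And>t. (4 * CARD('d) + 1) * card {h\<in>V. h t} < card V
                   \<or> (4 * CARD('d) + 1) * card {h\<in>V. \<not> h t} < card V"
  shows "card V \<le> 1"
proof (cases "V = {}")
  case True
  then show ?thesis
    by (simp)
next
  case False
  define c where "c = 4 * CARD('d) + 1"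
  note unsplit = unsplit[folded c_def]
  \<comment> \<open>Some location of each hypothesis; below, equal locations yield equal hypotheses,
    not conversely.\<close>
  define \<zeta> where "\<zeta> = inv (loc_hyp S)"
  have \<zeta>: "h = loc_hyp S (\<zeta> h)" if "h \<in> V" for h
    using that \<open>V \<subseteq> range (loc_hyp S)\<close> by (auto simp: \<zeta>_def f_inv_into_f)
  define w where "w h = x - \<zeta> h" for h
  have eval: "h (x + u) \<longleftrightarrow> w h + u \<in> S" if "h \<in> V" for h u
    by (subst \<zeta>[OF that]) (simp add: loc_hyp_def w_def algebra_simps)
  obtain M :: nat where M: "\<And>u j. u \<in> S \<Longrightarrow> \<bar>u $ j\<bar> \<le> int M"
    using bounded_lattice_setE[OF bdd] by blast
  have wS: "w h \<in> S" if "h \<in> V" for h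
    using x[OF that] eval[OF that, of 0] by simp
  \<comment> \<open>Two points of \<open>S\<close> differ by at most \<open>2 * M\<close> in any
    coordinate, so every ray has left \<open>S\<close> by step \<open>2 * M + 1\<close>.\<close>
  have far: "\<not> h (x + axis j a)" if "h \<in> V" "\<bar>a\<bar> > 2 * int M" for h j a
    using M[OF wS[OF that(1)], of j] M[of "w h + axis j a" j] that(2) eval[OF that(1)]
    by (auto simp: axis_def)
  \<comment> \<open>The sign \<open>\<sigma>\<close> selects one of the two opposite rays along axis
    \<open>j\<close>.\<close>
  have drop: "\<exists>p. c * card {h\<in>V. \<not> h (x + axis j (\<sigma> * int p)) \<or> h (x + axis j (\<sigma> * int (Suc p)))}
      \<le> 2 * card V" if "\<bar>\<sigma>\<bar> = 1" for j \<sigma>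
  proof (rule ex_common_drop[of V c "\<lambda>s h. h (x + axis j (\<sigma> * int s))" "2 * M + 1"])
    have "x + axis j (\<sigma> * int 0) = x"
      by (simp add: axis_eq_0_iff)
    then show "h (x + axis j (\<sigma> * int 0))" if "h \<in> V" for h
      using x[OF that] by metis
    show "\<not> h (x + axis j (\<sigma> * int (2 * M + 1)))" if "h \<in> V" for h
      by (rule far[OF that]) (simp add: abs_mult \<open>\<bar>\<sigma>\<bar> = 1\<close>)
  qed (use fin False unsplit in \<open>auto simp: c_def simp del: of_nat_Suc\<close>)
  have "\<exists>p. \<forall>j. c * card {h\<in>V. \<not> h (x + axis j (int (p j)))
      \<or> h (x + axis j (int (p j) + 1))} \<le> 2 * card V"
    using drop[of 1] by (intro choice) (simp add: add.commute)
  then obtain p where p: "\<And>j. c * card {h\<in>V. \<not> h (x + axis j (int (p j)))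
      \<or> h (x + axis j (int (p j) + 1))} \<le> 2 * card V"
    by blast
  have "\<exists>q. \<forall>j. c * card {h\<in>V. \<not> h (x + axis j (- int (q j)))
      \<or> h (x + axis j (- int (q j) - 1))} \<le> 2 * card V"
    using drop[of "-1"] by (intro choice) (simp add: minus_diff_commute)
  then obtain q where q: "\<And>j. c * card {h\<in>V. \<not> h (x + axis j (- int (q j)))
      \<or> h (x + axis j (- int (q j) - 1))} \<le> 2 * card V"
    by blast
  \<comment> \<open>\<open>P j\<close> and \<open>Q j\<close> collect the hypotheses that miss the
    common exit step on the positive and negative ray of axis \<open>j\<close>.\<close>
  define P where "P j = {h\<in>V. \<not> h (x + axis j (int (p j))) \<or> h (x + axis j (int (p j) + 1))}" for j
  define Q where "Q j = {h\<in>V. \<not> h (x + axis j (- int (q j))) \<or> h (x + axis j (- int (q j) - 1))}" for j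
  define B where "B = (\<Union>j. P j \<union> Q j)"
  have "B \<subseteq> V"
    unfolding B_def P_def Q_def by auto
  have PQ: "c * card (P j \<union> Q j) \<le> 4 * card V" for j
  proof -
    have "c * card (P j \<union> Q j) \<le> c * card (P j) + c * card (Q j)"
      by (metis card_Un_le mult_le_mono2 add_mult_distrib2)
    then show ?thesis
      using p[of j, folded P_def] q[of j, folded Q_def] by linarith
  qed
  have "card B \<le> (\<Sum>j\<in>UNIV. card (P j \<union> Q j))"
    unfolding B_def by (rule card_UN_le) simp
  then have "c * card B \<le> (\<Sum>j\<in>UNIV. c * card (P j \<union> Q j))"
    by (metis mult_le_mono2 sum_distrib_left)
  also have "\<dots> \<le> CARD('d) * (4 * card V)"
    using sum_bounded_above[of UNIV "\<lambda>j. c * card (P j \<union> Q j)"] PQ by simp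
  finally have B: "c * card B \<le> CARD('d) * (4 * card V)" .
  \<comment> \<open>The right-hand side does not depend on \<open>h\<close>, so all hypotheses
    outside \<open>B\<close> share one location.\<close>
  have coord: "2 * w h $ j = int (q j) - int (p j)" if "h \<in> V - B" for h j
  proof (rule coord_of_exit_times[OF sym conv])
    have "h \<in> V" "h \<notin> P j" "h \<notin> Q j"
      using that by (auto simp: B_def)
    then show "w h + axis j (int (p j)) \<in> S" "w h + axis j (int (p j) + 1) \<notin> S"
      "w h + axis j (- int (q j)) \<in> S" "w h + axis j (- int (q j) - 1) \<notin> S"
      using eval by (auto simp: P_def Q_def)
  qed
  have "h = h'" if "h \<in> V - B" "h' \<in> V - B" for h h'
  proof -
    have "w h $ j = w h' $ j" for j
      using coord[OF that(1), of j] coord[OF that(2), of j] by linarith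
    then have "\<zeta> h = \<zeta> h'"
      by (simp add: vec_eq_iff w_def)
    then show ?thesis
      using that by (metis DiffD1 \<zeta>)
  qed
  then have "card (V - B) \<le> 1"
    by (simp add: card_le_Suc0_iff_eq fin)
  then have "card V \<le> card B + 1"
    using card_Diff_subset[OF finite_subset[OF \<open>B \<subseteq> V\<close> fin] \<open>B \<subseteq> V\<close>] by simp
  then have "c * card V \<le> c * card B + c"
    using mult_le_mono2[of "card V" "card B + 1" c] by simp
  \<comment> \<open>Here the constant pays off: \<open>c\<close> exceeds the total loss factor 4d by
    exactly 1, so one copy of \<open>card V\<close> survives the cancellation.\<close>
  then have "card V \<le> c"
    using B by (simp add: c_def algebra_simps)
  have "{h\<in>V. h t} = {} \<or> {h\<in>V. \<not> h t} = {}" for t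
  proof -
    \<comment> \<open>A nonempty \<open>A\<close> would give
      \<open>c * card A \<ge> c \<ge> card V\<close>.\<close>
    have small: "A = {}" if "c * card A < card V" "A \<subseteq> V" for A
    proof -
      have "card A = 0"
        using mult_le_mono2[of 1 "card A" c] that(1) \<open>card V \<le> c\<close> by linarith
      then show ?thesis
        using finite_subset[OF that(2) fin] by simp
    qed
    show ?thesis
      by (rule disj_forward[OF unsplit[of t]]; erule small) auto
  qed
  then have agree: "h t = h' t" if "h \<in> V" "h' \<in> V" for h h' t
    using that by blast
  have "h = h'" if "h \<in> V" "h' \<in> V" for h h'
    by (rule ext) (rule agree[OF that])
  then show ?thesis
    by (simp add: card_le_Suc0_iff_eq fin)
qed

lemma avg_of_bool:
  assumes "finite V"
  shows "avg V (\<lambda>h. of_bool (P h)) = real (card {h\<in>V. P h}) / real (card V)"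
  using assms by (simp add: avg_def of_bool_def sum.If_cases Int_def)

text \<open>An average above 1 - 1/c means that the rejecting fraction is below 1/c.\<close>

lemma unsplit_card:
  fixes c :: nat
  assumes "finite V" and "V \<noteq> {}" and "c \<ge> 1"
    and "avg V (\<lambda>h. of_bool (P h)) \<notin> {1 / real c..1 - 1 / real c}"
  shows "c * card {h\<in>V. P h} < card V \<or> c * card {h\<in>V. \<not> P h} < card V"
proof -
  have pos: "0 < real (card V)" "0 < real c"
    using assms by (auto simp: card_gt_0_iff)
  have "card {h\<in>V. P h} + card {h\<in>V. \<not> P h} = card ({h\<in>V. P h} \<union> {h\<in>V. \<not> P h})"
    by (rule card_Un_disjoint[symmetric]) (use assms(1) in auto)
  also have "{h\<in>V. P h} \<union> {h\<in>V. \<not> P h} = V"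
    by auto
  finally have sum: "real (card {h\<in>V. P h}) = real (card V) - real (card {h\<in>V. \<not> P h})"
    by linarith
  have "real (card {h\<in>V. P h}) / real (card V) < 1 / real c
      \<or> real (card {h\<in>V. P h}) / real (card V) > 1 - 1 / real c"
    using assms(4) unfolding avg_of_bool[OF assms(1)] by auto
  then have "real c * real (card {h\<in>V. P h}) < real (card V)
      \<or> real c * real (card {h\<in>V. \<not> P h}) < real (card V)"
  proof
    assume "real (card {h\<in>V. P h}) / real (card V) < 1 / real c"
    then show ?thesis
      using pos by (simp add: field_simps)
  next
    assume "real (card {h\<in>V. P h}) / real (card V) > 1 - 1 / real c"
    then show ?thesis
      unfolding sum using pos by (simp add: field_simps)
  qed
  then show ?thesis
    by (simp flip: of_nat_mult)
qed

lemma strongly_connected_complete: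
  fixes G :: "'a pair_pre_digraph"
  assumes "pverts G = UNIV" and "parcs G = UNIV"
  shows "strongly_connected (with_proj G)"
proof -
  have "u \<rightarrow>\<^sup>*\<^bsub>with_proj G\<^esub> v" for u v
    unfolding reachable_def
    by (rule rtrancl_on_into_rtrancl_on[OF rtrancl_on_refl])
      (use assms in \<open>auto simp: arcs_ends_def arc_to_ends_def\<close>)
  then show ?thesis
    using assms by (simp add: strongly_connected_def)
qed

theorem theorem4p4:
  fixes S :: "(int ^ 'd) set"
    and H :: "(int ^ 'd \<Rightarrow> bool) set"
  assumes "bounded_lattice_set S"
    and "axis_symmetric S"
    and "axis_convex S"
    and "H \<subseteq> range (loc_hyp S)"
    and "finite H"
  shows "split_neighborly (4 * real CARD('d) + 1) H"
proof -
  define c where "c = 4 * CARD('d) + 1"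
  \<comment> \<open>Ensures 1/c \<le> 1/2, as the range of \<alpha> demands.\<close>
  have "c \<ge> 2"
    using zero_less_card_finite[where 'a = 'd] by (simp add: c_def del: zero_less_card_finite)
  have "card V \<le> 1 \<or> (\<exists>t. avg V (\<lambda>h. of_bool (h t)) \<in> {1 / real c..1 - 1 / real c})"
    if "V \<subseteq> Delta H x x'" for V x x'
  proof (rule disjCI)
    assume no_split: "\<not> (\<exists>t. avg V (\<lambda>h. of_bool (h t)) \<in> {1 / real c..1 - 1 / real c})"
    have V: "V \<subseteq> H" "\<And>h. h \<in> V \<Longrightarrow> h x'"
      using that by (auto simp: Delta_def)
    then have "finite V"
      using assms(5) finite_subset by blast
    show "card V \<le> 1"
    proof (cases "V = {}")
      case False
      show ?thesis
      proof (rule unsplit_imp_subsingleton[OF assms(1-3) _ \<open>finite V\<close> V(2), folded c_def])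
        show "c * card {h\<in>V. h t} < card V \<or> c * card {h\<in>V. \<not> h t} < card V" for t
          using unsplit_card[OF \<open>finite V\<close> False, of c "\<lambda>h. h t"] no_split \<open>c \<ge> 2\<close> by auto
      qed (use V(1) assms(4) in auto)
    qed simp
  qed
  then have "strongly_connected (with_proj (split_graph (1 / real c) H))"
    by (intro strongly_connected_complete) (auto simp: split_graph_def)
  then show ?thesis
    unfolding split_neighborly_def using \<open>c \<ge> 2\<close>
    by (intro exI[of _ "1 / real c"]) (simp add: field_simps, simp add: c_def)
qed

end
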